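(* Let $S\neq\mathbb{N}$ be a numerical semigroup and let $I$ be a relative ideal of $S$. Then $g(I)+g(S)\ge F(S)+t(I)$. Moreover, the following conditions are equivalent: (1) $I$ is almost canonical; (2) $g(I)+g(S)=F(S)+t(I)$; (3) $\widetilde I-M=K-M$; (4) $K-(M-M)\subseteq\widetilde I$; (5) if $x\in PF(I)\setminus\{F(I)\}$, then $F(I)-x\in PF(S)$.
   Context: A numerical semigroup is a submonoid $S$ of $(\mathbb{N},+)$ (with $0\in\mathbb{N}$) such that $\mathbb{N}\setminus S$ is finite. $F(S)=\max(\mathbb{Z}\setminus S)$, $M=S\setminus\{0\}$, $K=\{x\in\mathbb{N}\mid F(S)-x\notin S\}$. For sets $X,Y\subseteq\mathbb{Z}$, $X-Y=\{z\in\mathbb{Z}\mid z+Y\subseteq X\}$. A relative ideal of $S$ is a nonempty set $I\subseteq\mathbb{Z}$ with $I+S\subseteq I$ and $z+I\subseteq S$ for some $z\in S$. For a relative ideal $I$: $F(I)=\max(\mathbb{Z}\setminus I)$; $\widetilde I=I+(F(S)-F(I))$; $PF(I)=(I-M)\setminus I$; $t(I)=|PF(I)|$; $g(I)=|\mathbb{N}\setminus\widetilde I|$. In particular $PF(S)=(S-M)\setminus S$ and $g(S)=|\mathbb{N}\setminus S|$. The relative ideal $I$ is almost canonical if $\widetilde I-M=K\cup\{F(S)\}$. *)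

theory Defs
  imports Main "HOL-Library.Set_Algebras"
begin

text \<open>
  All sets are sets of integers, and \<open>\<nat>\<close> is the set of nonnegative integers.
  From Set_Algebras, \<open>I + S\<close> is the sumset and \<open>z +o I\<close> the translate \<open>z + I\<close>; the
  minus sign on sets remains set difference, so the quotient \<open>X - Y\<close> of
  ideals is written \<open>colon X Y\<close>.
\<close>

definition numerical_semigroup :: "int set \<Rightarrow> bool" where
  "numerical_semigroup S \<longleftrightarrow>
     S \<subseteq> \<nat> \<and> 0 \<in> S \<and> (\<forall>x\<in>S. \<forall>y\<in>S. x + y \<in> S) \<and> finite (\<nat> - S)"

definition relative_ideal :: "int set \<Rightarrow> int set \<Rightarrow> bool" where
  "relative_ideal S I \<longleftrightarrow> I \<noteq> {} \<and> I + S \<subseteq> I \<and> (\<exists>z\<in>S. z +o I \<subseteq> S)"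

definition colon :: "int set \<Rightarrow> int set \<Rightarrow> int set" where
  "colon X Y = {z. z +o Y \<subseteq> X}"

text \<open>The complement of a relative ideal is infinite (below), hence \<open>Greatest\<close> and not \<open>Max\<close>.\<close>

definition frobenius :: "int set \<Rightarrow> int" where
  "frobenius I = (GREATEST x. x \<notin> I)"

definition max_ideal :: "int set \<Rightarrow> int set" where
  "max_ideal S = S - {0}"

definition canonical_ideal :: "int set \<Rightarrow> int set" where
  "canonical_ideal S = {x \<in> \<nat>. frobenius S - x \<notin> S}"

definition shifted :: "int set \<Rightarrow> int set \<Rightarrow> int set" where
  "shifted S I = (frobenius S - frobenius I) +o I"

text \<open>In the following three notions the first argument is the ambient semigroup; the invariants
  of \<open>S\<close> itself are obtained for \<open>I = S\<close>.\<close>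

definition PF :: "int set \<Rightarrow> int set \<Rightarrow> int set" where
  "PF S I = colon I (max_ideal S) - I"

definition ideal_type :: "int set \<Rightarrow> int set \<Rightarrow> nat" where
  "ideal_type S I = card (PF S I)"

definition genus :: "int set \<Rightarrow> int set \<Rightarrow> nat" where
  "genus S I = card (\<nat> - shifted S I)"

definition almost_canonical :: "int set \<Rightarrow> int set \<Rightarrow> bool" where
  "almost_canonical S I \<longleftrightarrow>
     colon (shifted S I) (max_ideal S) = canonical_ideal S \<union> {frobenius S}"

lemma genus_self: "genus S S = card (\<nat> - S)"
  by (simp add: genus_def shifted_def elt_set_plus_def)

lemma relative_ideal_self: "numerical_semigroup S \<Longrightarrow> relative_ideal S S"
  unfolding numerical_semigroup_def relative_ideal_def
  by (auto simp: set_plus_def elt_set_plus_def)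

lemma frobenius_is_max:
  assumes S: "numerical_semigroup S" and I: "relative_ideal S I"
  shows "frobenius I \<notin> I" and "y \<notin> I \<Longrightarrow> y \<le> frobenius I"
proof -
  obtain i where i: "i \<in> I" using I by (auto simp: relative_ideal_def)
  obtain z where z: "z +o I \<subseteq> S" using I by (auto simp: relative_ideal_def)
  have fin: "finite (\<nat> - S)" and SN: "S \<subseteq> \<nat>"
    using S by (auto simp: numerical_semigroup_def)
  obtain b where b: "\<And>x. x \<in> \<nat> - S \<Longrightarrow> x \<le> b"
    using bdd_above_finite[OF fin] by (auto simp: bdd_above_def)
  have upper: "x \<le> i + max b 0" if "x \<notin> I" for x
  proof (rule ccontr)
    assume "\<not> x \<le> i + max b 0"
    then have "x - i > b" "x - i \<ge> 0" by auto
    then have "x - i \<in> S" using b[of "x - i"] by (auto simp: Nats_altdef1)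
    then have "i + (x - i) \<in> I"
      using I i unfolding relative_ideal_def by (blast intro: set_plus_intro)
    with that show False by simp
  qed
  have "- z - 1 \<notin> I"
  proof
    assume "- z - 1 \<in> I"
    then have "z + (- z - 1) \<in> S" using z by (auto simp: elt_set_plus_def)
    with SN show False by (auto simp: Nats_altdef1)
  qed
  let ?A = "{x. x \<notin> I \<and> - z - 1 \<le> x}"
  have finA: "finite ?A"
    by (rule finite_subset[of _ "{- z - 1..i + max b 0}"]) (auto dest: upper)
  have ne: "?A \<noteq> {}" using \<open>- z - 1 \<notin> I\<close> by blast
  have m: "Max ?A \<notin> I" using Max_in[OF finA ne] by blast
  have le: "y \<le> Max ?A" if "y \<notin> I" for y
  proof (cases "- z - 1 \<le> y")
    case True
    then show ?thesis using finA that by (intro Max_ge) auto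
  next
    case False
    then show ?thesis using Max_in[OF finA ne] by auto
  qed
  have eq: "frobenius I = Max ?A"
    unfolding frobenius_def by (rule Greatest_equality) (use m le in auto)
  show "frobenius I \<notin> I" using m eq by simp
  show "y \<le> frobenius I" if "y \<notin> I" using le[OF that] eq by simp
qed

end

theory Submission
  imports Defs
begin

text \<open>
  Write \<open>F\<close>, \<open>M\<close>, \<open>K\<close> for the Frobenius number, the maximal ideal and the canonical ideal of
  \<open>S\<close>; in these comments \<open>X - Y\<close> is the ideal quotient \<open>colon X Y\<close> and \<open>X \<setminus> Y\<close> the set
  difference. Translation changes neither the type nor condition (5), so everything can be
  read off the translate \<open>J\<close> of \<open>I\<close> whose Frobenius number is \<open>F\<close>. Such a \<open>J\<close> lies in \<open>K\<close>,
  and \<open>J - M\<close> lies in \<open>K \<union> {F}\<close>: if \<open>F - x\<close> were a nonzero element of \<open>S\<close>, then \<open>x \<in> J - M\<close>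
  would force \<open>F \<in> J\<close> (\<open>colon_max_ideal_subset\<close>). Moreover \<open>F \<in> J - M\<close>, because all integers
  above \<open>F\<close> belong to \<open>J\<close>.

  The reflection \<open>x \<mapsto> F - x\<close> matches the gaps of \<open>K\<close> with the elements of \<open>S\<close> below \<open>F\<close>, which
  gives \<open>g(J) + g(S) = F + 1 + |K \<setminus> J|\<close> (\<open>genus_sum\<close>). Since \<open>PF(J)\<close> is contained in
  \<open>(K \<setminus> J) \<union> {F}\<close>, the inequality follows, and equality means that \<open>PF(J)\<close> is all of
  this set, that is, \<open>J - M = K \<union> {F}\<close>.

  Almost canonicity thus amounts to the single inclusion \<open>K + M \<subseteq> J\<close>
  (\<open>colon_eq_iff\<close>), and the other conditions are rewritings of it. The ideal \<open>K\<close> itself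
  satisfies it, so \<open>K - M = K \<union> {F}\<close>, which is (3). The duality \<open>K - X = {z. F - z \<notin> X}\<close>,
  applied to \<open>X = M - M = S - M\<close>, identifies \<open>K - (M - M)\<close> with \<open>K + M\<close>, which is (4). For (5),
  \<open>F - x\<close> is a pseudo-Frobenius number of \<open>S\<close> for every \<open>x \<in> K \<setminus> (K + M)\<close>; conversely, a largest
  element of \<open>K \<setminus> (J - M)\<close> would produce a pseudo-Frobenius number of \<open>J\<close> that violates (5).
\<close>

section \<open>Semigroups with a positive Frobenius number\<close>

lemma mem_colon_iff: "z \<in> colon X Y \<longleftrightarrow> (\<forall>y\<in>Y. z + y \<in> X)"
  by (auto simp: colon_def elt_set_plus_def)

locale nontrivial_semigroup =
  fixes S :: "int set"
  assumes semigroup: "numerical_semigroup S" and proper: "S \<noteq> \<nat>"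
begin

abbreviation F :: int where "F \<equiv> frobenius S"
abbreviation M :: "int set" where "M \<equiv> max_ideal S"
abbreviation K :: "int set" where "K \<equiv> canonical_ideal S"

lemma zero_mem: "0 \<in> S"
  and add_mem: "x \<in> S \<Longrightarrow> y \<in> S \<Longrightarrow> x + y \<in> S"
  and nonneg: "x \<in> S \<Longrightarrow> 0 \<le> x"
  and finite_gaps: "finite (\<nat> - S)"
  using semigroup by (auto simp: numerical_semigroup_def Nats_altdef1)

lemma frobenius_notin: "F \<notin> S"
  and above_frobenius: "F < x \<Longrightarrow> x \<in> S"
  using frobenius_is_max[OF semigroup relative_ideal_self[OF semigroup]] by force+

lemma frobenius_pos: "0 < F"
proof -
  obtain x where x: "x \<in> \<nat>" "x \<notin> S"
    using proper semigroup by (auto simp: numerical_semigroup_def)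
  then have "0 < x"
    using zero_mem by (cases "x = 0") (auto simp: Nats_altdef1)
  with x(2) above_frobenius[of x] show ?thesis by linarith
qed

lemma mem_max_ideal_iff: "m \<in> M \<longleftrightarrow> m \<in> S \<and> 0 < m"
  using nonneg by (force simp: max_ideal_def)

text \<open>Negative integers are excluded from \<open>K\<close> automatically, because \<open>F - x > F\<close> for \<open>x < 0\<close>.\<close>

lemma mem_canonical_iff: "x \<in> K \<longleftrightarrow> F - x \<notin> S"
  using above_frobenius[of "F - x"] by (force simp: canonical_ideal_def Nats_altdef1)

text \<open>
  The duality of the canonical ideal: \<open>z + X\<close> meets the complement of \<open>K\<close> exactly when
  \<open>F - z \<in> X + S\<close>.
\<close>

lemma colon_canonical:
  assumes "\<And>x s. x \<in> X \<Longrightarrow> s \<in> S \<Longrightarrow> x + s \<in> X"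
  shows "colon K X = {z. F - z \<notin> X}"
proof -
  have "(\<forall>x\<in>X. F - (z + x) \<notin> S) \<longleftrightarrow> F - z \<notin> X" for z
  proof
    assume "\<forall>x\<in>X. F - (z + x) \<notin> S"
    then show "F - z \<notin> X" using zero_mem by force
  next
    assume "F - z \<notin> X"
    then show "\<forall>x\<in>X. F - (z + x) \<notin> S"
      using assms[of _ "F - (z + _)"] by force
  qed
  then show ?thesis by (auto simp: mem_colon_iff mem_canonical_iff)
qed

text \<open>
  A sum \<open>z + m\<close> with \<open>z \<in> S - M\<close> cannot vanish: \<open>z = - m\<close> would move \<open>F + m \<in> M\<close> to \<open>F \<notin> S\<close>.
  This needs \<open>F + m \<noteq> 0\<close>, hence \<open>S \<noteq> \<nat>\<close>; for \<open>S = \<nat>\<close> one has \<open>- 1 \<in> S - M\<close>.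
\<close>

lemma colon_max_ideal_max_ideal: "colon M M = colon S M"
proof -
  have "z + m \<noteq> 0" if z: "z \<in> colon S M" and m: "m \<in> M" for z m
  proof
    assume 0: "z + m = 0"
    have "F + m \<in> M"
      using m above_frobenius[of "F + m"] frobenius_pos by (auto simp: mem_max_ideal_iff)
    with z have "z + (F + m) \<in> S"
      unfolding mem_colon_iff by blast
    moreover have "z + (F + m) = F" using 0 by simp
    ultimately show False using frobenius_notin by simp
  qed
  then show ?thesis
    by (auto simp: mem_colon_iff max_ideal_def)
qed

lemma colon_canonical_max_ideals:
  "z \<in> colon K (colon M M) \<longleftrightarrow> (\<exists>k\<in>K. \<exists>m\<in>M. z = k + m)"
proof -
  have "x + s \<in> colon M M" if "x \<in> colon M M" "s \<in> S" for x s
    using that by (force simp: mem_colon_iff mem_max_ideal_iff nonneg add_mem add.assoc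
        intro: add_nonneg_pos)
  then have "z \<in> colon K (colon M M) \<longleftrightarrow> F - z \<notin> colon S M"
    using colon_canonical[of "colon M M"] by (simp add: colon_max_ideal_max_ideal)
  also have "\<dots> \<longleftrightarrow> (\<exists>m\<in>M. z - m \<in> K)"
    by (simp add: mem_colon_iff mem_canonical_iff algebra_simps)
  also have "\<dots> \<longleftrightarrow> (\<exists>k\<in>K. \<exists>m\<in>M. z = k + m)"
    by (metis add_diff_cancel_right' diff_add_cancel)
  finally show ?thesis .
qed

section \<open>Ideals with the Frobenius number of the semigroup\<close>

text \<open>
  The conditions say that \<open>J\<close> is an ideal with Frobenius number \<open>F\<close>, in a form that applies to
  \<open>K\<close> and to the translated ideal alike.
\<close>

definition normalized :: "int set \<Rightarrow> bool" where
  "normalized J \<longleftrightarrow>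
     (\<forall>x\<in>J. \<forall>s\<in>S. x + s \<in> J) \<and> F \<notin> J \<and> (\<forall>x>F. x \<in> J)"

lemma normalized_canonical: "normalized K"
proof -
  have "x + s \<in> K" if "x \<in> K" "s \<in> S" for x s
    using that add_mem[of "F - (x + s)" s] by (auto simp: mem_canonical_iff)
  then show ?thesis
    using zero_mem nonneg by (force simp: normalized_def mem_canonical_iff)
qed

lemma normalized_shifted:
  assumes "relative_ideal S I"
  shows "normalized (shifted S I)"
proof -
  have mem: "x \<in> shifted S I \<longleftrightarrow> x - (F - frobenius I) \<in> I" for x
    by (force simp: shifted_def elt_set_plus_def)
  have "x + s \<in> I" if "x \<in> I" "s \<in> S" for x s
    using that assms unfolding relative_ideal_def by (blast intro: set_plus_intro)
  then have "x + s - (F - frobenius I) \<in> I" if "x - (F - frobenius I) \<in> I" "s \<in> S" for x s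
    using that by (metis add_diff_eq diff_add_eq)
  moreover have "x - (F - frobenius I) \<in> I" if "F < x" for x
    using frobenius_is_max(2)[OF semigroup assms, of "x - (F - frobenius I)"] that by force
  ultimately show ?thesis
    using frobenius_is_max(1)[OF semigroup assms] by (simp add: normalized_def mem)
qed

context
  fixes J :: "int set"
  assumes J: "normalized J"
begin

lemma normalized_subset_canonical: "J \<subseteq> K"
  using J by (force simp: normalized_def mem_canonical_iff)

lemma subset_colon: "J \<subseteq> colon J M"
  using J by (auto simp: normalized_def mem_colon_iff mem_max_ideal_iff)

lemma frobenius_mem_colon: "F \<in> colon J M"
  using J by (auto simp: normalized_def mem_colon_iff mem_max_ideal_iff)

lemma colon_max_ideal_subset: "colon J M \<subseteq> insert F K"
proof
  fix x assume x: "x \<in> colon J M"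
  show "x \<in> insert F K"
  proof (rule ccontr)
    assume "x \<notin> insert F K"
    then have "F - x \<in> M"
      by (auto simp: mem_canonical_iff max_ideal_def)
    with x have "x + (F - x) \<in> J"
      unfolding mem_colon_iff by blast
    with J show False by (simp add: normalized_def)
  qed
qed

lemma colon_eq_iff:
  "colon J M = insert F K \<longleftrightarrow> (\<forall>k\<in>K. \<forall>m\<in>M. k + m \<in> J)"
  using colon_max_ideal_subset frobenius_mem_colon unfolding set_eq_iff subset_iff
  by (auto simp: mem_colon_iff)

lemma finite_canonical_diff: "finite (K - J)"
proof (rule finite_subset)
  show "K - J \<subseteq> {0..F}"
    using J by (auto simp: normalized_def canonical_ideal_def Nats_altdef1 not_less[symmetric])
qed simp

text \<open>
  Below \<open>F\<close>, the reflection \<open>x \<mapsto> F - x\<close> exchanges \<open>S\<close> with the complement of \<open>K\<close>, so the gaps of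
  \<open>S\<close> and of \<open>K\<close> together number \<open>|{0..F}| = F + 1\<close>.
\<close>

lemma genus_sum:
  "int (card (\<nat> - J)) + int (card (\<nat> - S)) = F + 1 + int (card (K - J))"
proof -
  let ?A = "{0..F} \<inter> S"
  have gaps: "\<nat> - S = {0..F} - S"
    using above_frobenius by (auto simp: Nats_altdef1 not_less[symmetric])
  have fin: "finite (\<nat> - K)" and card_K: "card (\<nat> - K) = card ?A"
  proof -
    have img: "\<nat> - K = (\<lambda>x. F - x) ` ?A"
    proof (intro subset_antisym subsetI)
      fix x assume "x \<in> \<nat> - K"
      then show "x \<in> (\<lambda>x. F - x) ` ?A"
        using nonneg[of "F - x"]
        by (intro image_eqI[of _ _ "F - x"]) (auto simp: mem_canonical_iff Nats_altdef1)
    qed (auto simp: mem_canonical_iff Nats_altdef1)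
    then show "finite (\<nat> - K)" by simp
    show "card (\<nat> - K) = card ?A"
      unfolding img by (rule card_image) (simp add: inj_on_def)
  qed
  have "card {0..F} = card ?A + card ({0..F} - S)"
    by (rule card_Int_Diff) simp
  then have symmetry: "int (card (\<nat> - K)) + int (card (\<nat> - S)) = F + 1"
    using frobenius_pos by (simp add: gaps card_K)
  have "\<nat> - J = (\<nat> - K) \<union> (K - J)"
    using normalized_subset_canonical by (auto simp: canonical_ideal_def)
  then have "card (\<nat> - J) = card (\<nat> - K) + card (K - J)"
    using card_Un_disjoint[OF fin finite_canonical_diff] by auto
  with symmetry show ?thesis by simp
qed

lemma PF_subset: "PF S J \<subseteq> insert F (K - J)"
  using colon_max_ideal_subset by (auto simp: PF_def)

lemma PF_eq_iff: "PF S J = insert F (K - J) \<longleftrightarrow> colon J M = insert F K"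
  using normalized_subset_canonical subset_colon J unfolding PF_def normalized_def by blast

lemma card_insert_canonical_diff: "card (insert F (K - J)) = card (K - J) + 1"
  using finite_canonical_diff zero_mem by (simp add: mem_canonical_iff)

lemma type_le: "F + int (card (PF S J)) \<le> int (card (\<nat> - J)) + int (card (\<nat> - S))"
  using card_mono[OF _ PF_subset] finite_canonical_diff
  by (simp add: genus_sum card_insert_canonical_diff)

lemma type_eq_iff:
  "int (card (\<nat> - J)) + int (card (\<nat> - S)) = F + int (card (PF S J))
     \<longleftrightarrow> colon J M = insert F K"
proof -
  have "int (card (\<nat> - J)) + int (card (\<nat> - S)) = F + int (card (PF S J))
      \<longleftrightarrow> card (PF S J) = card (insert F (K - J))"
    unfolding genus_sum card_insert_canonical_diff by linarith
  also have "\<dots> \<longleftrightarrow> PF S J = insert F (K - J)"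
    using card_subset_eq[OF _ PF_subset] finite_canonical_diff by auto
  finally show ?thesis by (simp add: PF_eq_iff)
qed

lemma colon_canonical_subset_iff:
  "colon K (colon M M) \<subseteq> J \<longleftrightarrow> colon J M = insert F K"
  unfolding colon_eq_iff subset_iff colon_canonical_max_ideals by blast

text \<open>
  For the forward direction, \<open>F - x + m \<notin> S\<close> would mean \<open>x - m \<in> K\<close>, hence \<open>x \<in> K + M \<subseteq> J\<close>.
  For the converse, if \<open>k\<close> is the largest element of \<open>K \<setminus> (J - M)\<close> and \<open>k + m \<notin> J\<close>, then
  \<open>k + m \<in> PF(J)\<close> by maximality, and \<open>F - (k + m) \<in> PF(S)\<close> gives \<open>F - k \<in> S\<close>, against \<open>k \<in> K\<close>.
\<close>

lemma reflect_PF_iff: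
  "(\<forall>x\<in>PF S J - {F}. F - x \<in> PF S S) \<longleftrightarrow> colon J M = insert F K"
proof
  assume eq: "colon J M = insert F K"
  show "\<forall>x\<in>PF S J - {F}. F - x \<in> PF S S"
  proof
    fix x assume "x \<in> PF S J - {F}"
    then have x: "x \<in> K" "x \<notin> J" using PF_subset by auto
    have "F - x + m \<in> S" if m: "m \<in> M" for m
    proof (rule ccontr)
      assume "F - x + m \<notin> S"
      then have "x - m \<in> K" by (simp add: mem_canonical_iff algebra_simps)
      with eq m have "x - m + m \<in> J" unfolding colon_eq_iff by blast
      with x(2) show False by simp
    qed
    with x(1) show "F - x \<in> PF S S"
      by (simp add: PF_def mem_colon_iff mem_canonical_iff)
  qed
next
  assume refl: "\<forall>x\<in>PF S J - {F}. F - x \<in> PF S S"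
  have "K - colon J M = {}"
  proof (rule ccontr)
    assume ne: "K - colon J M \<noteq> {}"
    have fin: "finite (K - colon J M)"
      using finite_canonical_diff by (rule rev_finite_subset) (use subset_colon in blast)
    define k where "k = Max (K - colon J M)"
    have k: "k \<in> K" "k \<notin> colon J M" using Max_in[OF fin ne] by (auto simp: k_def)
    from k(2) obtain m where m: "m \<in> M" "k + m \<notin> J" by (auto simp: mem_colon_iff)
    have km: "k + m \<in> K"
      using normalized_canonical k(1) m(1) by (auto simp: normalized_def mem_max_ideal_iff)
    have "k < k + m" using m(1) by (simp add: mem_max_ideal_iff)
    then have "k + m \<notin> K - colon J M"
      using Max_ge[OF fin, of "k + m"] by (auto simp: k_def)
    with km m(2) have "k + m \<in> PF S J" by (simp add: PF_def)
    moreover have "k + m \<noteq> F" using km normalized_canonical by (auto simp: normalized_def)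
    ultimately have "F - (k + m) \<in> colon S M" using refl by (simp add: PF_def)
    with m(1) have "F - (k + m) + m \<in> S" unfolding mem_colon_iff by blast
    with k(1) show False by (simp add: mem_canonical_iff)
  qed
  then show "colon J M = insert F K"
    using colon_max_ideal_subset frobenius_mem_colon by blast
qed

end

lemma colon_canonical_max_ideal: "colon K M = insert F K"
  using normalized_canonical
  by (simp add: colon_eq_iff normalized_def mem_max_ideal_iff)

end

section \<open>Translation and the characterization\<close>

lemma PF_translate: "PF S (c +o I) = c +o PF S I"
proof -
  have "x \<in> c +o X \<longleftrightarrow> x - c \<in> X" for x and X :: "int set"
    by (force simp: elt_set_plus_def)
  then show ?thesis
    unfolding set_eq_iff by (simp add: PF_def mem_colon_iff diff_add_eq)
qed

lemma card_PF_shifted: "card (PF S (shifted S I)) = ideal_type S I"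
proof -
  have "PF S (shifted S I) = (+) (frobenius S - frobenius I) ` PF S I"
    unfolding shifted_def PF_translate by (auto simp: elt_set_plus_def)
  then show ?thesis by (simp add: card_image ideal_type_def)
qed

lemma reflect_PF_shifted:
  "(\<forall>x\<in>PF S (shifted S I) - {frobenius S}. frobenius S - x \<in> P)
     \<longleftrightarrow> (\<forall>x\<in>PF S I - {frobenius I}. frobenius I - x \<in> P)"
proof -
  let ?c = "frobenius S - frobenius I"
  have "(\<forall>x\<in>?c +o X - {frobenius S}. frobenius S - x \<in> P)
      \<longleftrightarrow> (\<forall>y\<in>X. ?c + y \<noteq> frobenius S \<longrightarrow> frobenius S - (?c + y) \<in> P)" for X
    unfolding elt_set_plus_def by blast
  then show ?thesis
    unfolding shifted_def PF_translate by (auto simp: algebra_simps)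
qed

theorem proposition2p4:
  fixes S I :: "int set"
  assumes "numerical_semigroup S" and "S \<noteq> \<nat>" and "relative_ideal S I"
  shows "int (genus S I) + int (genus S S) \<ge> frobenius S + int (ideal_type S I)
    \<and> (almost_canonical S I \<longleftrightarrow>
         int (genus S I) + int (genus S S) = frobenius S + int (ideal_type S I))
    \<and> (almost_canonical S I \<longleftrightarrow>
         colon (shifted S I) (max_ideal S) = colon (canonical_ideal S) (max_ideal S))
    \<and> (almost_canonical S I \<longleftrightarrow>
         colon (canonical_ideal S) (colon (max_ideal S) (max_ideal S)) \<subseteq> shifted S I)
    \<and> (almost_canonical S I \<longleftrightarrow>
         (\<forall>x \<in> PF S I - {frobenius I}. frobenius I - x \<in> PF S S))"
proof -
  interpret nontrivial_semigroup S
    using assms by unfold_locales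
  let ?J = "shifted S I"
  have J: "normalized ?J"
    using assms(3) by (rule normalized_shifted)
  have ac: "almost_canonical S I \<longleftrightarrow> colon ?J M = insert F K"
    by (simp add: almost_canonical_def)
  have gI: "genus S I = card (\<nat> - ?J)"
    by (simp add: genus_def)
  show ?thesis
    unfolding ac gI genus_self card_PF_shifted[symmetric] reflect_PF_shifted[symmetric]
      colon_canonical_max_ideal
    using type_le[OF J] type_eq_iff[OF J] colon_canonical_subset_iff[OF J] reflect_PF_iff[OF J]
    by blast
qed

end
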